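(* Let $w \in \mathfrak{S}_n$ and $k \in [1,n-2]$. Then $w$ interlaces $k$ and $k+1$ if and only if the permutation $w^{\langle k\rangle}$ contains a $321$-pattern centered at $k+1$.
   Context: $\mathfrak{S}_n$ is the symmetric group generated by adjacent transpositions $\sigma_i=(i\ i+1)$; permutations are composed right to left and written in one-line notation $w=w(1)w(2)\cdots w(n)$. A reduced word for $w$ is a word $a_1\cdots a_\ell$ with $w=\sigma_{a_1}\cdots\sigma_{a_\ell}$ and $\ell$ minimal. The letters $k$ and $k+1$ are interlaced in $w$ if the reduced words of $w$ contain both $k$ and $k+1$ and some reduced word of $w$ contains a (not necessarily consecutive) subsequence $k,\,k+1,\,k$ or $k+1,\,k,\,k+1$. Construction of $w^{\langle k\rangle}$: set $m := w^{-1}(k+1)$. (1) If $m=k+1$, then $w^{\langle k\rangle}:=w$. (2) If $m>k+1$ and $w(k+1)>k+1$, or if $m<k+1$ and $w(k+1)<k+1$, then $w^{\langle k\rangle}(i)=w(i)$ for $i\notin\{m,k+1\}$, $w^{\langle k\rangle}(k+1)=k+1$, and $w^{\langle k\rangle}(m)=w(k+1)$. (3) If $m>k+1$ and $w(k+1)<k+1$, let $t$ be the maximal $t<k+1$ with $w(t)>k+1$; if $m<k+1$ and $w(k+1)>k+1$, let $t$ be the minimal $t>k+1$ with $w(t)<k+1$. In either case $w^{\langle k\rangle}(i)=w(i)$ for $i\notin\{m,k+1,t\}$, $w^{\langle k\rangle}(k+1)=k+1$, $w^{\langle k\rangle}(t)=w(k+1)$, and $w^{\langle k\rangle}(m)=w(t)$.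 In all cases $w^{\langle k\rangle}$ fixes $k+1$. If a permutation $u$ fixes $h$, then $u$ has a $321$-pattern centered at $h$ if there exist $i<h<j$ with $u(i)>h>u(j)$ (i.e., a $321$-pattern whose middle entry is the value $h$ in position $h$). *)

theory Defs
  imports "HOL-Combinatorics.Permutations" "HOL-Library.Sublist"
begin

text \<open>
  Elements of the symmetric group on n letters are functions w on the natural numbers with
  \<^term>\<open>w permutes {1..n}\<close>; the product is composition, taken from right to left.
\<close>

definition adj_transp :: "nat \<Rightarrow> nat \<Rightarrow> nat" where
  "adj_transp i = transpose i (i + 1)"

definition word_perm :: "nat list \<Rightarrow> nat \<Rightarrow> nat" where
  "word_perm as = foldr (\<lambda>a p. adj_transp a \<circ> p) as id"

definition word_for :: "nat \<Rightarrow> (nat \<Rightarrow> nat) \<Rightarrow> nat list \<Rightarrow> bool" where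
  "word_for n w as \<longleftrightarrow> set as \<subseteq> {1..<n} \<and> w = word_perm as"

definition reduced_word :: "nat \<Rightarrow> (nat \<Rightarrow> nat) \<Rightarrow> nat list \<Rightarrow> bool" where
  "reduced_word n w as \<longleftrightarrow>
     word_for n w as \<and> (\<forall>bs. word_for n w bs \<longrightarrow> length as \<le> length bs)"

text \<open>
  \<^const>\<open>subseq\<close> is the relation of being a not necessarily contiguous subsequence.
\<close>

definition interlaces :: "nat \<Rightarrow> (nat \<Rightarrow> nat) \<Rightarrow> nat \<Rightarrow> bool" where
  "interlaces n w k \<longleftrightarrow>
     (\<forall>as. reduced_word n w as \<longrightarrow> k \<in> set as \<and> k + 1 \<in> set as) \<and>
     (\<exists>as. reduced_word n w as \<and> (subseq [k, k + 1, k] as \<or> subseq [k + 1, k, k + 1] as))"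

text \<open>
  The permutation written w with superscript k in angle brackets. As w is injective,
  \<^term>\<open>m = k + 1\<close> holds iff \<^term>\<open>w (k + 1) = k + 1\<close>, so the last branch covers exactly
  the remaining case \<^term>\<open>m < k + 1\<close>, \<^term>\<open>w (k + 1) > k + 1\<close>. As w is the identity
  outside \<^term>\<open>{1..n}\<close>, the values t below lie in \<^term>\<open>{1..n}\<close> without this being
  demanded; they exist by the pigeonhole principle.
\<close>

definition angle_perm :: "(nat \<Rightarrow> nat) \<Rightarrow> nat \<Rightarrow> nat \<Rightarrow> nat" where
  "angle_perm w k =
     (let m = inv w (k + 1) in
      if m = k + 1 then w
      else if m > k + 1 \<and> w (k + 1) > k + 1 \<or> m < k + 1 \<and> w (k + 1) < k + 1 then
        w(k + 1 := k + 1, m := w (k + 1))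
      else
        let t = (if m > k + 1 \<and> w (k + 1) < k + 1
                 then GREATEST t. t < k + 1 \<and> w t > k + 1
                 else LEAST t. t > k + 1 \<and> w t < k + 1)
        in w(k + 1 := k + 1, t := w (k + 1), m := w t))"

definition has_321_centered :: "nat \<Rightarrow> (nat \<Rightarrow> nat) \<Rightarrow> nat \<Rightarrow> bool" where
  "has_321_centered n u h \<longleftrightarrow>
     u h = h \<and> (\<exists>i\<in>{1..n}. \<exists>j\<in>{1..n}. i < h \<and> h < j \<and> u i > h \<and> h > u j)"

end

theory Submission imports Defs begin

text \<open>
  Put h = k + 1. In a word in which no k follows an h, the product maps {..<h} into {..h};
  conversely, along a reduced word each letter moves the larger value to the left, and this
  forces every reduced word of such a permutation to have all its letters k before its letters h.
  Passing to inverses gives the mirrored statement, so w interlaces k and h iff some i < h has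
  w i > h and some j > h has w j < h. This is a 321-pattern centered at h except that w need not
  fix h; a count of the values below h shows that the repair done by \<^const>\<open>angle_perm\<close>
  does not change whether both kinds of positions exist.
\<close>

section \<open>Words and reduced words\<close>

lemma word_perm_simps [simp]:
  "word_perm [] = id"
  "word_perm (a # as) = adj_transp a \<circ> word_perm as"
  by (simp_all add: word_perm_def)

lemma word_perm_append [simp]: "word_perm (as @ bs) = word_perm as \<circ> word_perm bs"
  by (induction as) (simp_all add: comp_assoc)

lemma adj_transp_comp_self [simp]: "adj_transp a \<circ> adj_transp a = id"
  by (simp add: adj_transp_def)

lemma adj_transp_involutory [simp]: "adj_transp a (adj_transp a i) = i"
  by (simp add: adj_transp_def)

lemma word_perm_rev_comp: "word_perm (rev as) \<circ> word_perm as = id"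
proof (induction as)
  case (Cons a as)
  have "word_perm (rev (a # as)) \<circ> word_perm (a # as)
      = word_perm (rev as) \<circ> (adj_transp a \<circ> adj_transp a) \<circ> word_perm as"
    by (simp only: rev.simps word_perm_append word_perm_simps comp_assoc id_comp comp_id)
  then show ?case using Cons by simp
qed simp

lemma word_perm_rev_apply: "word_perm (rev as) (word_perm as i) = i"
  using word_perm_rev_comp[of as] by (metis comp_apply id_apply)

lemma word_perm_apply_rev: "word_perm as (word_perm (rev as) i) = i"
  using word_perm_rev_apply[of "rev as"] by simp

lemma inj_word_perm: "inj (word_perm as)"
  by (metis injI word_perm_rev_apply)

lemma word_perm_rev: "word_perm (rev as) = inv (word_perm as)"
  by (rule inv_unique_comp[symmetric])
     (use word_perm_rev_comp[of as] word_perm_rev_comp[of "rev as"] in simp_all)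

text \<open>This is the exchange condition at a right descent. Peel letters off the left: either the
  tail already has the descent, or the first letter creates it and can be deleted.\<close>

lemma word_perm_exchange:
  assumes "word_perm as a > word_perm as (a + 1)"
  shows "\<exists>bs. length bs < length as \<and> set bs \<subseteq> set as \<and>
           word_perm bs = word_perm as \<circ> adj_transp a"
  using assms
proof (induction as)
  case (Cons b as)
  let ?v = "word_perm as"
  have ne: "?v a \<noteq> ?v (a + 1)"
    using inj_word_perm[of as] by (metis injD n_not_Suc_n Suc_eq_plus1)
  show ?case
  proof (cases "?v a > ?v (a + 1)")
    case True
    with Cons.IH obtain bs where bs: "length bs < length as" "set bs \<subseteq> set as"
      "word_perm bs = ?v \<circ> adj_transp a" by blast
    then show ?thesis by (intro exI[of _ "b # bs"]) (auto simp: comp_assoc)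
  next
    case False
    \<comment> \<open>Applying \<open>adj_transp b\<close> on the left reverses the order of no pair
      of values but \<open>b\<close> and \<open>b + 1\<close>.\<close>
    with ne Cons.prems have v: "?v a = b" "?v (a + 1) = b + 1"
      by (auto simp: adj_transp_def transpose_def split: if_splits)
    have "adj_transp b (?v (adj_transp a i)) = ?v i" for i
    proof -
      have "?v i = b \<longleftrightarrow> i = a" "?v i = b + 1 \<longleftrightarrow> i = a + 1"
        using v inj_word_perm[of as] by (metis injD)+
      with v show ?thesis by (auto simp: adj_transp_def transpose_def)
    qed
    then have "?v = word_perm (b # as) \<circ> adj_transp a" by auto
    then show ?thesis by (metis length_Cons lessI set_subset_Cons)
  qed
qed simp

text \<open>Competing words use only letters of the word itself, which avoids the ambient
  \<open>n\<close>. The exchange lemma introduces no new letters, so this comparison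
  suffices.\<close>

definition reduced :: "nat list \<Rightarrow> bool" where
  "reduced as \<longleftrightarrow>
     (\<forall>bs. set bs \<subseteq> set as \<and> word_perm bs = word_perm as \<longrightarrow> length as \<le> length bs)"

lemma reduced_word_imp_reduced:
  "reduced_word n w as \<Longrightarrow> reduced as"
  by (auto simp: reduced_word_def word_for_def reduced_def)

lemma reduced_rev:
  assumes "reduced as"
  shows "reduced (rev as)"
  unfolding reduced_def
proof safe
  fix bs assume bs: "set bs \<subseteq> set (rev as)" "word_perm bs = word_perm (rev as)"
  then have "word_perm (rev bs) = word_perm as"
    by (metis rev_rev_ident word_perm_rev)
  with bs assms show "length (rev as) \<le> length bs"
    unfolding reduced_def by (metis length_rev set_rev)
qed

text \<open>A shorter word for the prefix could be extended by \<open>a\<close>. A descent at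
  \<open>a\<close> would let the exchange lemma produce a word shorter than
  \<open>as @ [a]\<close>.\<close>

lemma reduced_snocD:
  assumes "reduced (as @ [a])"
  shows "reduced as" "word_perm as a < word_perm as (a + 1)"
proof -
  show "reduced as"
    unfolding reduced_def
  proof safe
    fix bs assume "set bs \<subseteq> set as" "word_perm bs = word_perm as"
    then have "set (bs @ [a]) \<subseteq> set (as @ [a])" "word_perm (bs @ [a]) = word_perm (as @ [a])"
      by auto
    with assms have "length (as @ [a]) \<le> length (bs @ [a])"
      unfolding reduced_def by blast
    then show "length as \<le> length bs" by simp
  qed
  show "word_perm as a < word_perm as (a + 1)"
  proof (rule ccontr)
    assume "\<not> ?thesis"
    moreover have "word_perm as a \<noteq> word_perm as (a + 1)"
      using inj_word_perm[of as] by (metis injD n_not_Suc_n Suc_eq_plus1)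
    ultimately have "word_perm as a > word_perm as (a + 1)" by simp
    then obtain bs where bs: "length bs < length as" "set bs \<subseteq> set as"
      "word_perm bs = word_perm as \<circ> adj_transp a" using word_perm_exchange by blast
    then have "set bs \<subseteq> set (as @ [a])" "word_perm bs = word_perm (as @ [a])" by auto
    with assms have "length (as @ [a]) \<le> length bs"
      unfolding reduced_def by blast
    with bs show False by simp
  qed
qed

text \<open>Together with \<open>permutes_word\<close> this yields the existence of reduced words,
  which \<open>interlaces_iff\<close> relies on.\<close>

lemma transpose_word:
  assumes "1 \<le> a" "a + d \<le> n"
  shows "\<exists>as. word_for n (transpose a (a + d)) as"
  using assms(2)
proof (induction d)
  case 0
  then show ?case by (intro exI[of _ "[]"]) (simp add: word_for_def fun_eq_iff)
next
  case (Suc d)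
  then obtain as where as: "word_for n (transpose a (a + d)) as" by auto
  let ?b = "a + d"
  have bs: "set bs \<subseteq> {1..<n}" if "set bs \<subseteq> {?b} \<union> set as" for bs
    using that as Suc.prems assms(1) by (auto simp: word_for_def)
  show ?case
  proof (cases "d = 0")
    case True
    then have "transpose a (a + Suc d) = word_perm [?b]" by (simp add: adj_transp_def)
    moreover have "set [?b] \<subseteq> {1..<n}" by (rule bs) auto
    ultimately show ?thesis unfolding word_for_def by blast
  next
    case False
    \<comment> \<open>Conjugation moves the endpoint \<open>a + d\<close> to
      \<open>a + d + 1\<close> and fixes \<open>a\<close>, since \<open>d\<close> is
      nonzero.\<close>
    have "word_perm (?b # as @ [?b]) = adj_transp ?b \<circ> transpose a ?b \<circ> adj_transp ?b"
      using as by (simp add: word_for_def comp_assoc)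
    also have "\<dots> = transpose a (a + Suc d)"
      using False by (auto simp: adj_transp_def transpose_def fun_eq_iff)
    finally have "transpose a (a + Suc d) = word_perm (?b # as @ [?b])" ..
    moreover have "set (?b # as @ [?b]) \<subseteq> {1..<n}" by (rule bs) auto
    ultimately show ?thesis unfolding word_for_def by blast
  qed
qed

lemma permutes_word:
  assumes "w permutes {1..n}"
  shows "\<exists>as. word_for n w as"
  using assms finite_atLeastAtMost
proof (induction rule: permutes_induct)
  case id
  then show ?case by (intro exI[of _ "[]"]) (simp add: word_for_def id_def)
next
  case (swap a b p)
  have "\<exists>as. word_for n (transpose a b) as"
  proof (cases "a \<le> b")
    case True
    with swap transpose_word[of a "b - a" n] show ?thesis by simp
  next
    case False
    with swap transpose_word[of b "a - b" n] show ?thesis by (simp add: transpose_commute)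
  qed
  then obtain as bs where "word_for n (transpose a b) as" "word_for n p bs"
    using swap by blast
  then show ?case by (intro exI[of _ "as @ bs"]) (auto simp: word_for_def)
qed

lemma reduced_word_exists:
  assumes "w permutes {1..n}"
  shows "\<exists>as. reduced_word n w as"
  using permutes_word[OF assms] ex_has_least_nat[of "word_for n w" _ length]
  unfolding reduced_word_def by blast

section \<open>Interlacing in terms of values\<close>

lemma subseq_imp_set_subset: "subseq xs ys \<Longrightarrow> set xs \<subseteq> set ys"
  by (induction rule: list_emb.induct) auto

lemma subseq_pair_snoc:
  "subseq [x, y] (as @ [a]) \<longleftrightarrow> subseq [x, y] as \<or> a = y \<and> x \<in> set as"
  by (induction as) (auto simp: subseq_singleton_left)

lemma subseq_pair_rev: "subseq [x, y] (rev as) \<longleftrightarrow> subseq [y, x] as"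
  by (induction as) (auto simp: subseq_pair_snoc subseq_singleton_left dest: subseq_imp_set_subset)

text \<open>Given both orders, suppose the first letter among \<open>x\<close>, \<open>y\<close> to
  occur is \<open>x\<close>. It precedes the \<open>y\<close> of the pair \<open>y\<close>,
  \<open>x\<close>, giving \<open>x\<close>, \<open>y\<close>, \<open>x\<close>; the other case is
  symmetric.\<close>

lemma subseq_alternating_iff:
  assumes "x \<noteq> y"
  shows "subseq [x, y, x] as \<or> subseq [y, x, y] as \<longleftrightarrow> subseq [x, y] as \<and> subseq [y, x] as"
  using assms by (induction as) (auto simp: subseq_singleton_left dest: subseq_imp_set_subset)

lemma word_perm_le_if_not_subseq:
  fixes k :: nat
  shows "k + 1 \<notin> set as \<Longrightarrow> i \<le> k + 1 \<Longrightarrow> word_perm as i \<le> k + 1"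
    and "\<not> subseq [k + 1, k] as \<Longrightarrow> i < k + 1 \<Longrightarrow> word_perm as i \<le> k + 1"
proof -
  have "(k + 1 \<notin> set as \<longrightarrow> (\<forall>i\<le>k + 1. word_perm as i \<le> k + 1)) \<and>
        (\<not> subseq [k + 1, k] as \<longrightarrow> (\<forall>i<k + 1. word_perm as i \<le> k + 1))"
  proof (induction as rule: rev_induct)
    case (snoc a as)
    have 1: "a \<noteq> k + 1 \<Longrightarrow> i \<le> k + 1 \<Longrightarrow> adj_transp a i \<le> k + 1" for i
      by (auto simp: adj_transp_def transpose_def)
    have 2: "a \<noteq> k \<Longrightarrow> i < k + 1 \<Longrightarrow> adj_transp a i < k + 1" for i
      by (auto simp: adj_transp_def transpose_def)
    have 3: "a = k \<Longrightarrow> i < k + 1 \<Longrightarrow> adj_transp a i \<le> k + 1" for i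
      by (auto simp: adj_transp_def transpose_def)
    \<comment> \<open>The last letter acts first. If it is \<open>k\<close>, it may send
      \<open>k\<close> to \<open>k + 1\<close>, but then no \<open>k + 1\<close> stands to its left
      and the first claim applies to the prefix.\<close>
    show ?case
      unfolding subseq_pair_snoc using snoc 1 2 3 by (cases "a = k") auto
  qed auto
  then show "k + 1 \<notin> set as \<Longrightarrow> i \<le> k + 1 \<Longrightarrow> word_perm as i \<le> k + 1"
    and "\<not> subseq [k + 1, k] as \<Longrightarrow> i < k + 1 \<Longrightarrow> word_perm as i \<le> k + 1" by auto
qed

text \<open>
  The induction also shows that once h = k + 1 has occurred, position h carries a value above h;
  a later letter k would move that value into a position below h.
\<close>

lemma reduced_not_subseq_if_le:
  fixes k :: nat
  assumes "reduced as" "\<forall>i<k + 1. word_perm as i \<le> k + 1"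
  shows "\<not> subseq [k + 1, k] as \<and> (k + 1 \<in> set as \<longrightarrow> word_perm as (k + 1) > k + 1)"
  using assms
proof (induction as rule: rev_induct)
  case (snoc a as)
  let ?v = "word_perm as"
  note red = reduced_snocD[OF snoc.prems(1)]
  have P': "?v (adj_transp a i) \<le> k + 1" if "i < k + 1" for i
    using snoc.prems(2) that by simp
  \<comment> \<open>The hypothesis passes to the prefix: only \<open>a = k\<close>,
    \<open>i = k\<close> leaves the range below \<open>k + 1\<close>, and there the ascent
    \<open>?v k < ?v (k + 1)\<close> helps.\<close>
  have P: "?v i \<le> k + 1" if "i < k + 1" for i
  proof (cases "a = k \<and> i = k")
    case True
    with P'[of k] red(2) show ?thesis by (simp add: adj_transp_def)
  next
    case False
    with that have "adj_transp a i < k + 1 \<or> a = k \<and> i < k"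
      by (auto simp: adj_transp_def transpose_def)
    then show ?thesis
      using P'[of "adj_transp a i"] P'[of i] that by (auto simp: adj_transp_def)
  qed
  with snoc.IH red(1) have IH: "\<not> subseq [k + 1, k] as"
    "k + 1 \<in> set as \<Longrightarrow> ?v (k + 1) > k + 1" by auto
  consider "a = k" | "a = k + 1" | "a \<noteq> k" "a \<noteq> k + 1" by blast
  then show ?case
  proof cases
    case 1
    \<comment> \<open>By the induction hypothesis this bound rules out the letter
      \<open>k + 1\<close> in the prefix.\<close>
    with P'[of k] have "?v (k + 1) \<le> k + 1" by (simp add: adj_transp_def)
    with IH 1 show ?thesis unfolding subseq_pair_snoc by auto
  next
    case 2
    \<comment> \<open>The new letter brings this value to position \<open>k + 1\<close>. Were it
      small, the ascent would make \<open>?v (k + 1)\<close> small too, and the \<open>k + 3\<close>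
      positions \<open>0..k + 2\<close> would inject into \<open>k + 2\<close> values.\<close>
    have "?v (k + 2) > k + 1"
    proof (rule ccontr)
      assume "\<not> ?thesis"
      with red(2) 2 have "?v (k + 1) \<le> k + 1" "?v (k + 2) \<le> k + 1" by simp_all
      moreover have "i < k + 1 \<or> i = k + 1 \<or> i = k + 2" if "i \<le> k + 2" for i
        using that by linarith
      ultimately have "?v ` {..k + 2} \<subseteq> {..k + 1}" using P by blast
      then have "card (?v ` {..k + 2}) \<le> card {..k + 1}" by (rule card_mono[rotated]) simp
      then show False by (simp add: card_image inj_on_subset[OF inj_word_perm])
    qed
    with IH 2 show ?thesis unfolding subseq_pair_snoc by (simp add: adj_transp_def)
  next
    case 3
    with IH show ?thesis
      unfolding subseq_pair_snoc by (simp add: adj_transp_def transpose_def)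
  qed
qed simp

lemma reduced_subseq_iff:
  assumes "reduced as"
  shows "subseq [k + 1, k] as \<longleftrightarrow> (\<exists>i<k + 1. word_perm as i > k + 1)"
    and "subseq [k, k + 1] as \<longleftrightarrow> (\<exists>j>k + 1. word_perm as j < k + 1)"
proof -
  have *: "subseq [k + 1, k] bs \<longleftrightarrow> (\<exists>i<k + 1. word_perm bs i > k + 1)" if "reduced bs" for bs
    using reduced_not_subseq_if_le[OF that, of k] word_perm_le_if_not_subseq(2)[of k bs]
    by (meson not_le)
  show "subseq [k + 1, k] as \<longleftrightarrow> (\<exists>i<k + 1. word_perm as i > k + 1)"
    by (rule *[OF assms])
  have "subseq [k, k + 1] as \<longleftrightarrow> (\<exists>i<k + 1. word_perm (rev as) i > k + 1)"
    using *[OF reduced_rev[OF assms]] by (simp only: subseq_pair_rev)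
  \<comment> \<open>The reversed word is the inverse, so positions and values trade places.\<close>
  also have "\<dots> \<longleftrightarrow> (\<exists>j>k + 1. word_perm as j < k + 1)"
    by (metis word_perm_apply_rev word_perm_rev_apply)
  finally show "subseq [k, k + 1] as \<longleftrightarrow> (\<exists>j>k + 1. word_perm as j < k + 1)" .
qed

lemma interlaces_iff:
  assumes "w permutes {1..n}"
  shows "interlaces n w k \<longleftrightarrow> (\<exists>i<k + 1. w i > k + 1) \<and> (\<exists>j>k + 1. w j < k + 1)"
    (is "_ \<longleftrightarrow> ?R")
proof -
  \<comment> \<open>The right-hand side does not mention the word, so all reduced words of
    \<open>w\<close> behave alike and a single one decides.\<close>
  have *: "subseq [k, k + 1, k] as \<or> subseq [k + 1, k, k + 1] as \<longleftrightarrow> ?R"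
    if "reduced_word n w as" for as
  proof -
    have "w = word_perm as" using that by (simp add: reduced_word_def word_for_def)
    then show ?thesis
      using subseq_alternating_iff[of k "k + 1" as]
        reduced_subseq_iff[OF reduced_word_imp_reduced[OF that], of k] by auto
  qed
  have "k \<in> set as \<and> k + 1 \<in> set as"
    if "subseq [k, k + 1, k] as \<or> subseq [k + 1, k, k + 1] as" for as
    using that by (auto dest!: subseq_imp_set_subset)
  with * have "k \<in> set as \<and> k + 1 \<in> set as" if "reduced_word n w as" ?R for as
    using that by blast
  with * reduced_word_exists[OF assms] show ?thesis
    unfolding interlaces_def by blast
qed

section \<open>The repaired permutation\<close>

text \<open>Both the positions below \<open>h\<close> and the positions of values below
  \<open>h\<close> number \<open>h\<close>. Cancel their common part \<open>?C\<close>.\<close>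

lemma card_crossings:
  fixes w :: "nat \<Rightarrow> nat"
  assumes "bij w"
  shows "card {i. i < h \<and> w i > h} + card {i. i < h \<and> w i = h}
       = card {j. j > h \<and> w j < h} + card {j. j = h \<and> w j < h}"
proof -
  let ?C = "{i. i < h \<and> w i < h}"
  let ?A = "{i. i < h \<and> w i > h}" and ?Ah = "{i. i < h \<and> w i = h}"
  let ?B = "{j. j > h \<and> w j < h}" and ?Bh = "{j. j = h \<and> w j < h}"
  have card_Un3: "card (X \<union> Y \<union> Z) = card X + card Y + card Z"
    if "finite (X \<union> Y \<union> Z)" "X \<inter> Y = {}" "(X \<union> Y) \<inter> Z = {}" for X Y Z :: "nat set"
    using that by (simp add: card_Un_disjoint)
  have inj: "inj w" and surj: "surj w" using assms by (simp_all add: bij_def)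
  have "card (w -` {..<h}) = h"
    using card_vimage_inj[OF inj, of "{..<h}"] surj by simp
  moreover have "w -` {..<h} = ?C \<union> ?B \<union> ?Bh" by force
  moreover have "finite (w -` {..<h})" using inj by (simp add: finite_vimageI)
  moreover have "card (?C \<union> ?B \<union> ?Bh) = card ?C + card ?B + card ?Bh"
    if "finite (?C \<union> ?B \<union> ?Bh)"
    by (rule card_Un3[OF that]) auto
  ultimately have "h = card ?C + card ?B + card ?Bh" by simp
  moreover have "{..<h} = ?C \<union> ?A \<union> ?Ah" by auto
  then have "h = card (?C \<union> ?A \<union> ?Ah)" by (metis card_lessThan)
  moreover have "card (?C \<union> ?A \<union> ?Ah) = card ?C + card ?A + card ?Ah"
    by (rule card_Un3) auto
  ultimately show ?thesis by linarith
qed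

text \<open>\<open>A - {t}\<close> and \<open>B\<close> have equal size, so they are empty together,
  while \<open>t\<close> witnesses that \<open>A\<close> is nonempty. This handles the repair that
  changes three positions.\<close>

lemma Diff_singleton_nonempty_iff:
  assumes "t \<in> A" "card A = card B + 1" "finite B"
  shows "A - {t} \<noteq> {} \<and> B \<noteq> {} \<longleftrightarrow> A \<noteq> {} \<and> B \<noteq> {}"
proof -
  have fin: "finite A" using assms(2) by (auto intro: card_ge_0_finite)
  then have "card (A - {t}) = card B" using assms by simp
  then have "A - {t} = {} \<longleftrightarrow> B = {}" using fin assms(3) by (metis card_eq_0_iff finite_Diff)
  then show ?thesis using assms(1) by blast
qed

lemma has_321_angle_perm_iff:
  assumes w: "w permutes {1..n}"
  shows "has_321_centered n (angle_perm w k) (k + 1) \<longleftrightarrow>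
         (\<exists>i<k + 1. w i > k + 1) \<and> (\<exists>j>k + 1. w j < k + 1)"
proof -
  define h where "h = k + 1"
  define m where "m = inv w h"
  define u where "u = angle_perm w k"
  define A where "A v = {i. i < h \<and> v i > h}" for v :: "nat \<Rightarrow> nat"
  define B where "B v = {j. j > h \<and> v j < h}" for v :: "nat \<Rightarrow> nat"
  have bij: "bij w" using w by (rule permutes_bij)
  have inj: "w i = w j \<longleftrightarrow> i = j" for i j using bij by (metis bij_pointE)
  have wm: "w m = h" using bij by (simp add: m_def bij_is_surj surj_f_inv_f)
  have m: "w i = h \<longleftrightarrow> i = m" for i using wm inj by metis
  have out: "w i = i" if "i \<notin> {1..n}" for i using w that by (simp add: permutes_def)
  have A1: "A w \<subseteq> {1..n}" and B1: "B w \<subseteq> {1..n}"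
    using out by (force simp: A_def B_def)+
  have fin: "finite (A w)" "finite (B w)"
    using A1 B1 by (auto intro: finite_subset)
  have u_eq: "u = (if m = h then w
      else if m > h \<and> w h > h \<or> m < h \<and> w h < h then w(h := h, m := w h)
      else let t = (if m > h \<and> w h < h then GREATEST t. t \<in> A w else LEAST t. t \<in> B w)
           in w(h := h, t := w h, m := w t))"
    unfolding u_def angle_perm_def h_def[symmetric] m_def[symmetric] A_def B_def Let_def
    by simp
  \<comment> \<open>The value \<open>h\<close> sits only at \<open>m\<close>, so the correction
    terms record whether \<open>m < h\<close> and whether \<open>w h < h\<close>.\<close>
  have counts: "card (A w) + card {i. i < h \<and> i = m} = card (B w) + card {j. j = h \<and> w j < h}"
    using card_crossings[OF bij, of h] by (simp only: m A_def B_def)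
  have main: "u h = h \<and> A u \<subseteq> A w \<and> B u \<subseteq> B w \<and>
      (A u \<noteq> {} \<and> B u \<noteq> {} \<longleftrightarrow> A w \<noteq> {} \<and> B w \<noteq> {})"
  proof -
    consider "m = h" | "m > h" "w h > h" | "m < h" "w h < h"
      | "m > h" "w h < h" | "m < h" "w h > h"
      using m[of h] by (metis nat_neq_iff)
    then show ?thesis
    proof cases
      case 1
      then show ?thesis using wm by (simp add: u_eq)
    next
      case 2
      \<comment> \<open>Here and in the next case, \<open>m\<close> and its new value
        \<open>w h\<close> lie on the same side of \<open>h\<close>, so \<open>m\<close> joins
        neither set; before, its value was \<open>h\<close>.\<close>
      then have "u = w(h := h, m := w h)" by (simp add: u_eq)
      with 2 wm have "A u = A w" "B u = B w" "u h = h" by (auto simp: A_def B_def)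
      then show ?thesis by simp
    next
      case 3
      then have "u = w(h := h, m := w h)" by (simp add: u_eq)
      with 3 wm have "A u = A w" "B u = B w" "u h = h" by (auto simp: A_def B_def)
      then show ?thesis by simp
    next
      case 4
      define t where "t = (GREATEST t. t \<in> A w)"
      have u: "u = w(h := h, t := w h, m := w t)"
        using 4 by (simp add: u_eq t_def Let_def)
      have "{i. i < h \<and> i = m} = {}" "{j. j = h \<and> w j < h} = {h}" using 4 by auto
      with counts have card: "card (A w) = card (B w) + 1" by simp
      then have "A w \<noteq> {}" by auto
      then have "\<exists>t. t \<in> A w" by blast
      then have t: "t \<in> A w"
        unfolding t_def by (rule GreatestI_ex_nat[where b = h]) (simp add: A_def)
      \<comment> \<open>Position \<open>t < h\<close> receives \<open>w h < h\<close> and leaves the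
        set; position \<open>m > h\<close> receives \<open>w t > h\<close> and does not enter
        \<open>B\<close>. The next case is the mirror image.\<close>
      with 4 wm u have "A u = A w - {t}" "B u = B w" "u h = h" by (auto simp: A_def B_def)
      then show ?thesis using Diff_singleton_nonempty_iff[OF t card] fin by auto
    next
      case 5
      define t where "t = (LEAST t. t \<in> B w)"
      have u: "u = w(h := h, t := w h, m := w t)"
        using 5 by (simp add: u_eq t_def Let_def)
      have "{i. i < h \<and> i = m} = {m}" "{j. j = h \<and> w j < h} = {}" using 5 by auto
      with counts have card: "card (B w) = card (A w) + 1" by simp
      then have "B w \<noteq> {}" by auto
      then have "\<exists>t. t \<in> B w" by blast
      then have t: "t \<in> B w" unfolding t_def by (rule LeastI_ex)
      with 5 wm u have "B u = B w - {t}" "A u = A w" "u h = h" by (auto simp: A_def B_def)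
      then show ?thesis using Diff_singleton_nonempty_iff[OF t card] fin by auto
    qed
  qed
  have "has_321_centered n u h \<longleftrightarrow> A u \<noteq> {} \<and> B u \<noteq> {}"
  proof -
    \<comment> \<open>The inclusions in \<open>main\<close> give the range: \<open>w\<close> fixes
      every point outside \<open>{1..n}\<close>, so no such point crosses \<open>h\<close>.\<close>
    have "A u \<subseteq> {1..n}" "B u \<subseteq> {1..n}" "u h = h" using main A1 B1 by blast+
    moreover have "has_321_centered n u h \<longleftrightarrow>
        u h = h \<and> (\<exists>i\<in>{1..n}. i \<in> A u) \<and> (\<exists>j\<in>{1..n}. j \<in> B u)"
      unfolding has_321_centered_def A_def B_def by blast
    ultimately show ?thesis by blast
  qed
  with main have "has_321_centered n u h \<longleftrightarrow> A w \<noteq> {} \<and> B w \<noteq> {}" by blast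
  then show ?thesis unfolding u_def h_def A_def B_def by blast
qed

theorem theorem3p3:
  fixes n k :: nat and w :: "nat \<Rightarrow> nat"
  assumes "w permutes {1..n}" and "1 \<le> k" and "k + 2 \<le> n"
  shows "interlaces n w k \<longleftrightarrow> has_321_centered n (angle_perm w k) (k + 1)"
  using interlaces_iff[OF assms(1)] has_321_angle_perm_iff[OF assms(1)] by simp

end
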